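(* Let $p\in[1,\infty)$, $d\in\mathbb N$, and let $(T,\mathcal B,\mu)$ be a finite measure space such that $L^p_{\mathbb R^d}=L^p_{\mathbb R^d}(T,\mathcal B,\mu)$ is separable. Let $X=(X_t)_{t\in T}=(X_{1,t},\dots,X_{d,t})_{t\in T}$ be a bi-measurable $\mathbb R^d$-valued process with $\mathbb E\|X\|_p^p<\infty$, and write $X_i=(X_{i,t})_{t\in T}$. For every $n,n_1,\dots,n_d\in\mathbb N$ such that $\prod_{i=1}^dn_i\le n$, $$\sum_{i=1}^de_{n,p}(X_i,L^p)^p\le e_{n,p}(X,L^p_{\mathbb R^d})^p\le\sum_{i=1}^de_{n_i,p}(X_i,L^p)^p .$$
   Context: $L^p_{\mathbb R^d}$ is equipped with the norm $\|f\|_p=\big(\sum_{i=1}^d\int|f_i(t)|^p\,d\mu(t)\big)^{1/p}$, and $L^p=L^p_{\mathbb R}(T,\mathcal B,\mu)$ with the usual norm. The processes $X$ and $X_i$ are viewed as random vectors with values in $L^p_{\mathbb R^d}$ and $L^p$ respectively; bi-measurable means that $(\omega,t)\mapsto X_t(\omega)$ is jointly measurable. For a random variable $Y$ in a Banach space $(G,\|\cdot\|)$, $m\in\mathbb N$ and $r\in(0,\infty)$, $$e_{m,r}(Y,G):=\inf\Big\{\big(\mathbb E\min_{a\in\alpha}\|Y-a\|^r\big)^{1/r}:\alpha\subset G,\ 1\le\mathrm{card}(\alpha)\le m\Big\}.$$ *)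

theory Defs
  imports "HOL-Probability.Probability"
begin

(* Power with a positive real exponent on [0, \<infinity>]. *)
definition enn_powr :: "ennreal \<Rightarrow> real \<Rightarrow> ennreal" where
  "enn_powr x r = (if x = \<infinity> then \<infinity> else ennreal (enn2real x powr r))"

(* The part of the structure of a normed space G that enters ||y - a||.  An explicit carrier
   is needed because L^p depends on a measure and an exponent, so it cannot be a type. *)
record 'g nspace =
  points :: "'g set"
  diff :: "'g \<Rightarrow> 'g \<Rightarrow> 'g"
  nrm :: "'g \<Rightarrow> real"

definition separable_nspace :: "'g nspace \<Rightarrow> bool" where
  "separable_nspace G \<longleftrightarrow>
     (\<exists>D. D \<subseteq> points G \<and> countable D \<and>
          (\<forall>x\<in>points G. \<forall>\<epsilon>>0. \<exists>y\<in>D. nrm G (diff G x y) < \<epsilon>))"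

(* The quantization error e_{m,r}(Y,G); it is [0, \<infinity>]-valued so that an infinite
   r-th moment of Y needs no separate treatment. *)
definition quant_error ::
  "'w measure \<Rightarrow> nat \<Rightarrow> real \<Rightarrow> ('w \<Rightarrow> 'g) \<Rightarrow> 'g nspace \<Rightarrow> ennreal" where
  "quant_error M m r Y G =
     Inf {enn_powr (\<integral>\<^sup>+\<omega>. Min ((\<lambda>a. ennreal (nrm G (diff G (Y \<omega>) a) powr r)) ` \<alpha>) \<partial>M) (1 / r)
          | \<alpha>. \<alpha> \<subseteq> points G \<and> finite \<alpha> \<and> 1 \<le> card \<alpha> \<and> card \<alpha> \<le> m}"

(* Summing over the standard orthonormal basis covers R and R^d at once;
   see eLp_norm_real and eLp_norm_vec below. *)
definition eLp_norm :: "'t measure \<Rightarrow> real \<Rightarrow> ('t \<Rightarrow> 'e::euclidean_space) \<Rightarrow> ennreal" where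
  "eLp_norm \<mu> p f =
     enn_powr (\<Sum>b\<in>Basis. \<integral>\<^sup>+t. ennreal (\<bar>f t \<bullet> b\<bar> powr p) \<partial>\<mu>) (1 / p)"

definition Lp_fun :: "'t measure \<Rightarrow> real \<Rightarrow> ('t \<Rightarrow> 'e::euclidean_space) set" where
  "Lp_fun \<mu> p = {f \<in> borel_measurable \<mu>. eLp_norm \<mu> p f < \<infinity>}"

definition Lp_rel :: "'t measure \<Rightarrow> real \<Rightarrow> (('t \<Rightarrow> 'e::euclidean_space) \<times> ('t \<Rightarrow> 'e)) set" where
  "Lp_rel \<mu> p = {(f, g). f \<in> Lp_fun \<mu> p \<and> g \<in> Lp_fun \<mu> p \<and> (AE t in \<mu>. f t = g t)}"

(* The element of L^p represented by f.  If f is not p-integrable this is the empty set, which is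
   not an element of L^p; for the paths of a process X with E||X||^p < \<infinity> this happens
   only on a null set, where it does not affect expectations. *)
definition Lp_class :: "'t measure \<Rightarrow> real \<Rightarrow> ('t \<Rightarrow> 'e::euclidean_space) \<Rightarrow> ('t \<Rightarrow> 'e) set" where
  "Lp_class \<mu> p f = Lp_rel \<mu> p `` {f}"

definition Lp :: "'t measure \<Rightarrow> real \<Rightarrow> ('t \<Rightarrow> 'e::euclidean_space) set nspace" where
  "Lp \<mu> p =
     \<lparr> points = Lp_fun \<mu> p // Lp_rel \<mu> p,
       diff = (\<lambda>A B. \<Union>f\<in>A. \<Union>g\<in>B. Lp_class \<mu> p (\<lambda>t. f t - g t)),
       nrm = (\<lambda>A. the_elem ((\<lambda>f. enn2real (eLp_norm \<mu> p f)) ` A)) \<rparr>"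

lemma eLp_norm_real:
  fixes f :: "'t \<Rightarrow> real"
  shows "eLp_norm \<mu> p f = enn_powr (\<integral>\<^sup>+t. ennreal (\<bar>f t\<bar> powr p) \<partial>\<mu>) (1 / p)"
  by (simp add: eLp_norm_def)

lemma eLp_norm_vec:
  fixes f :: "'t \<Rightarrow> real ^ 'd"
  shows "eLp_norm \<mu> p f =
    enn_powr (\<Sum>i\<in>UNIV. \<integral>\<^sup>+t. ennreal (\<bar>f t $ i\<bar> powr p) \<partial>\<mu>) (1 / p)"
proof -
  have B: "(Basis :: (real ^ 'd) set) = (\<lambda>i. axis i 1) ` UNIV"
    by (auto simp: Basis_vec_def)
  have "inj (\<lambda>i. axis i 1 :: real ^ 'd)"
    by (auto simp: inj_on_def axis_eq_axis)
  then show ?thesis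
    by (simp add: eLp_norm_def B sum.reindex cart_eq_inner_axis)
qed

lemma equiv_Lp_rel: "equiv (Lp_fun \<mu> p) (Lp_rel \<mu> p)"
proof (rule equivI)
  show "trans (Lp_rel \<mu> p)"
  proof (rule transI)
    fix f g h
    assume fg: "(f, g) \<in> Lp_rel \<mu> p" and gh: "(g, h) \<in> Lp_rel \<mu> p"
    have "AE t in \<mu>. f t = g t" "AE t in \<mu>. g t = h t"
      using fg gh by (simp_all add: Lp_rel_def)
    then have "AE t in \<mu>. f t = h t"
      by eventually_elim simp
    with fg gh show "(f, h) \<in> Lp_rel \<mu> p"
      by (simp add: Lp_rel_def)
  qed
next
  show "sym (Lp_rel \<mu> p)"
  proof (rule symI)
    fix f g
    assume fg: "(f, g) \<in> Lp_rel \<mu> p"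
    then have "AE t in \<mu>. f t = g t"
      by (simp add: Lp_rel_def)
    then have "AE t in \<mu>. g t = f t"
      by eventually_elim simp
    with fg show "(g, f) \<in> Lp_rel \<mu> p"
      by (simp add: Lp_rel_def)
  qed
qed (auto simp: Lp_rel_def refl_on_def)

lemma eLp_norm_cong_AE:
  assumes "AE t in \<mu>. f t = g t"
  shows "eLp_norm \<mu> p f = eLp_norm \<mu> p g"
proof -
  have "(\<integral>\<^sup>+t. ennreal (\<bar>f t \<bullet> b\<bar> powr p) \<partial>\<mu>) = (\<integral>\<^sup>+t. ennreal (\<bar>g t \<bullet> b\<bar> powr p) \<partial>\<mu>)" for b
    by (rule nn_integral_cong_AE) (use assms in eventually_elim, simp)
  then show ?thesis
    by (simp add: eLp_norm_def)
qed

lemma nrm_Lp_class: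
  assumes "f \<in> Lp_fun \<mu> p"
  shows "nrm (Lp \<mu> p) (Lp_class \<mu> p f) = enn2real (eLp_norm \<mu> p f)"
proof -
  have f: "f \<in> Lp_class \<mu> p f"
    using assms by (auto simp: Lp_class_def Lp_rel_def)
  have eq: "eLp_norm \<mu> p g = eLp_norm \<mu> p f" if "g \<in> Lp_class \<mu> p f" for g
  proof -
    have "AE t in \<mu>. f t = g t"
      using that by (simp add: Lp_class_def Lp_rel_def)
    from eLp_norm_cong_AE[OF this] show ?thesis
      by (rule sym)
  qed
  have "(\<lambda>g. enn2real (eLp_norm \<mu> p g)) ` Lp_class \<mu> p f =
      (\<lambda>_. enn2real (eLp_norm \<mu> p f)) ` Lp_class \<mu> p f"
    by (rule image_cong[OF refl]) (rule arg_cong[OF eq])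
  also have "\<dots> = {enn2real (eLp_norm \<mu> p f)}"
    using f by blast
  finally show ?thesis
    by (simp add: Lp_def)
qed

lemma diff_Lp_class:
  assumes f: "f \<in> Lp_fun \<mu> p" and g: "g \<in> Lp_fun \<mu> p"
  shows "diff (Lp \<mu> p) (Lp_class \<mu> p f) (Lp_class \<mu> p g) = Lp_class \<mu> p (\<lambda>t. f t - g t)"
proof -
  have ne: "f \<in> Lp_class \<mu> p f" "g \<in> Lp_class \<mu> p g"
    using f g by (auto simp: Lp_class_def Lp_rel_def)
  have "Lp_class \<mu> p (\<lambda>t. f' t - g' t) = Lp_class \<mu> p (\<lambda>t. f t - g t)"
    if f': "f' \<in> Lp_class \<mu> p f" and g': "g' \<in> Lp_class \<mu> p g" for f' g'
  proof -
    have ae: "AE t in \<mu>. f t = f' t" "AE t in \<mu>. g t = g' t"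
      using f' g' by (auto simp: Lp_class_def Lp_rel_def)
    have AE: "AE t in \<mu>. f' t - g' t = f t - g t"
      using ae by eventually_elim auto
    have "f \<in> borel_measurable \<mu>" "f' \<in> borel_measurable \<mu>"
         "g \<in> borel_measurable \<mu>" "g' \<in> borel_measurable \<mu>"
      using f g f' g' by (auto simp: Lp_class_def Lp_rel_def Lp_fun_def)
    then have mem: "(\<lambda>t. f' t - g' t) \<in> Lp_fun \<mu> p \<longleftrightarrow> (\<lambda>t. f t - g t) \<in> Lp_fun \<mu> p"
      using eLp_norm_cong_AE[OF AE, of p] by (simp add: Lp_fun_def)
    have "(AE t in \<mu>. f' t - g' t = h t) \<longleftrightarrow> (AE t in \<mu>. f t - g t = h t)" for h
      by (rule eventually_cong[OF AE]) simp
    with mem show ?thesis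
      by (auto simp: Lp_class_def Lp_rel_def)
  qed
  with ne show ?thesis
    unfolding Lp_def nspace.simps by blast
qed

end

theory Submission
  imports Defs
begin

text \<open>
  Write \<open>N f\<close> for the \<open>p\<close>-th power of the \<open>L\<^sup>p\<close> norm.  The theorem rests on
  \<open>N\<close> being additive over coordinates: \<open>N f\<close> is the sum of \<open>N f\<^sub>i\<close> over the coordinate functions.
  The \<open>p\<close>-th power of the quantization error is the infimum over codebooks of
  \<open>\<integral> (INF f\<in>F. N (X - f))\<close> (lemma \<open>enn_powr_quant_error\<close>), so both inequalities compare an
  infimum of a sum with a sum of infima.

  For the lower bound, the coordinate projections of a codebook of size at most \<open>n\<close> for \<open>X\<close> are
  codebooks of size at most \<open>n\<close> for the \<open>X\<^sub>i\<close>, and minimising the coordinates separately can only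
  decrease the sum.  For the upper bound, codebooks \<open>A\<^sub>i\<close> of size at most \<open>n\<^sub>i\<close> combine into a
  product codebook of size at most \<open>\<Prod> n\<^sub>i \<le> n\<close>.  The choices in different coordinates are independent
  there, so the minimum of the sum is the sum of the minima.  The codebooks \<open>A\<^sub>i\<close> are independent of
  each other too, so the same exchange (lemma \<open>INF_PiE_sum_le\<close>), applied a second time, lets
  each of them be optimised on its own.
\<close>

section \<open>Powers on the extended half-line\<close>

lemma enn_powr_mono:
  assumes "0 \<le> r" "x \<le> y"
  shows "enn_powr x r \<le> enn_powr y r"
proof (cases "y = \<infinity>")
  case False
  then have "x \<noteq> \<infinity>" "enn2real x \<le> enn2real y"
    using assms(2) by (auto simp: top_unique less_top intro!: enn2real_mono)
  then show ?thesis
    using False assms(1) by (auto simp: enn_powr_def intro!: ennreal_leI powr_mono2)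
qed (simp add: enn_powr_def)

lemma enn_powr_inverse:
  assumes "0 < r"
  shows "enn_powr (enn_powr x (1 / r)) r = x" "enn_powr (enn_powr x r) (1 / r) = x"
  using assms by (auto simp: enn_powr_def powr_powr less_top)

lemma enn_powr_less_top_iff: "enn_powr x r < \<infinity> \<longleftrightarrow> x < \<infinity>"
  by (auto simp: enn_powr_def less_top)

section \<open>The p-th power of the norm\<close>

definition Lp_power :: "'t measure \<Rightarrow> real \<Rightarrow> ('t \<Rightarrow> 'e::euclidean_space) \<Rightarrow> ennreal" where
  "Lp_power \<mu> p f = (\<Sum>b\<in>Basis. \<integral>\<^sup>+t. ennreal (\<bar>f t \<bullet> b\<bar> powr p) \<partial>\<mu>)"

lemma eLp_norm_eq_Lp_power: "eLp_norm \<mu> p f = enn_powr (Lp_power \<mu> p f) (1 / p)"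
  by (simp add: eLp_norm_def Lp_power_def)

lemma Lp_fun_iff: "f \<in> Lp_fun \<mu> p \<longleftrightarrow> f \<in> borel_measurable \<mu> \<and> Lp_power \<mu> p f < \<infinity>"
  by (simp add: Lp_fun_def eLp_norm_eq_Lp_power enn_powr_less_top_iff del: infinity_ennreal_def)

lemma Lp_power_vec:
  fixes f :: "'t \<Rightarrow> real ^ 'd"
  shows "Lp_power \<mu> p f = (\<Sum>i\<in>UNIV. Lp_power \<mu> p (\<lambda>t. f t $ i))"
proof -
  have B: "(Basis :: (real ^ 'd) set) = (\<lambda>i. axis i 1) ` UNIV"
    by (auto simp: Basis_vec_def)
  have "inj (\<lambda>i. axis i 1 :: real ^ 'd)"
    by (auto simp: inj_on_def axis_eq_axis)
  then show ?thesis
    by (simp add: Lp_power_def B sum.reindex cart_eq_inner_axis)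
qed

lemma borel_measurable_vec_nth:
  fixes f :: "'a \<Rightarrow> real ^ 'd"
  assumes [measurable]: "f \<in> borel_measurable N"
  shows "(\<lambda>x. f x $ i) \<in> borel_measurable N"
  unfolding cart_eq_inner_axis by measurable

lemma Lp_fun_vec_iff:
  fixes f :: "'t \<Rightarrow> real ^ 'd"
  shows "f \<in> Lp_fun \<mu> p \<longleftrightarrow> (\<forall>i. (\<lambda>t. f t $ i) \<in> Lp_fun \<mu> p)"
proof -
  have "f \<in> borel_measurable \<mu> \<longleftrightarrow> (\<forall>i. (\<lambda>t. f t $ i) \<in> borel_measurable \<mu>)"
  proof
    show "\<forall>i. (\<lambda>t. f t $ i) \<in> borel_measurable \<mu>" if "f \<in> borel_measurable \<mu>"
      using that by (intro allI borel_measurable_vec_nth)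
    show "f \<in> borel_measurable \<mu>" if "\<forall>i. (\<lambda>t. f t $ i) \<in> borel_measurable \<mu>"
      by (subst borel_measurable_euclidean_space)
        (use that in \<open>auto simp: Basis_vec_def cart_eq_inner_axis\<close>)
  qed
  then show ?thesis
    by (auto simp: Lp_fun_iff Lp_power_vec)
qed

lemma abs_diff_powr_le:
  fixes a b p :: real
  assumes "0 \<le> p"
  shows "\<bar>a - b\<bar> powr p \<le> 2 powr p * (\<bar>a\<bar> powr p + \<bar>b\<bar> powr p)"
proof -
  have "\<bar>a - b\<bar> powr p \<le> (2 * max \<bar>a\<bar> \<bar>b\<bar>) powr p"
    using assms by (intro powr_mono2) auto
  also have "\<dots> = 2 powr p * max \<bar>a\<bar> \<bar>b\<bar> powr p"
    by (simp add: powr_mult)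
  also have "\<dots> \<le> 2 powr p * (\<bar>a\<bar> powr p + \<bar>b\<bar> powr p)"
    by (intro mult_left_mono) (auto simp: max_def)
  finally show ?thesis .
qed

lemma Lp_fun_diff:
  assumes p: "0 \<le> p" and f: "f \<in> Lp_fun \<mu> p" and g: "g \<in> Lp_fun \<mu> p"
  shows "(\<lambda>t. f t - g t) \<in> Lp_fun \<mu> p"
proof -
  have [measurable]: "f \<in> borel_measurable \<mu>" "g \<in> borel_measurable \<mu>"
    using f g by (auto simp: Lp_fun_iff)
  have "(\<integral>\<^sup>+t. ennreal (\<bar>(f t - g t) \<bullet> b\<bar> powr p) \<partial>\<mu>) < \<infinity>" if b: "b \<in> Basis" for b
  proof -
    have fin: "(\<integral>\<^sup>+t. ennreal (\<bar>f t \<bullet> b\<bar> powr p) \<partial>\<mu>) < \<infinity>"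
         "(\<integral>\<^sup>+t. ennreal (\<bar>g t \<bullet> b\<bar> powr p) \<partial>\<mu>) < \<infinity>"
      using f g b by (auto simp: Lp_fun_iff Lp_power_def)
    have "(\<integral>\<^sup>+t. ennreal (\<bar>(f t - g t) \<bullet> b\<bar> powr p) \<partial>\<mu>)
      \<le> (\<integral>\<^sup>+t. ennreal (2 powr p) * (ennreal (\<bar>f t \<bullet> b\<bar> powr p) + ennreal (\<bar>g t \<bullet> b\<bar> powr p)) \<partial>\<mu>)"
      using p by (intro nn_integral_mono)
        (auto simp: inner_diff_left simp flip: ennreal_plus ennreal_mult
              intro!: ennreal_leI abs_diff_powr_le)
    also have "\<dots> = ennreal (2 powr p) *
        ((\<integral>\<^sup>+t. ennreal (\<bar>f t \<bullet> b\<bar> powr p) \<partial>\<mu>) + (\<integral>\<^sup>+t. ennreal (\<bar>g t \<bullet> b\<bar> powr p) \<partial>\<mu>))"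
      by (simp add: nn_integral_cmult nn_integral_add)
    also have "\<dots> < \<infinity>"
      using fin by (simp add: ennreal_mult_less_top)
    finally show ?thesis .
  qed
  then show ?thesis
    by (auto simp: Lp_fun_iff Lp_power_def)
qed

lemma borel_measurable_Lp_power_section:
  fixes Y :: "'t \<Rightarrow> 'w \<Rightarrow> 'e::euclidean_space"
  assumes "sigma_finite_measure \<mu>"
    and [measurable]: "(\<lambda>(\<omega>, t). Y t \<omega>) \<in> borel_measurable (M \<Otimes>\<^sub>M \<mu>)"
    and [measurable]: "f \<in> borel_measurable \<mu>"
  shows "(\<lambda>\<omega>. Lp_power \<mu> p (\<lambda>t. Y t \<omega> - f t)) \<in> borel_measurable M"
proof -
  interpret sigma_finite_measure \<mu> by fact
  show ?thesis
    unfolding Lp_power_def by measurable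
qed

lemma ennreal_nrm_diff_Lp_class_powr:
  assumes p: "0 < p" and f: "f \<in> Lp_fun \<mu> p" and g: "g \<in> Lp_fun \<mu> p"
  shows "ennreal (nrm (Lp \<mu> p) (diff (Lp \<mu> p) (Lp_class \<mu> p f) (Lp_class \<mu> p g)) powr p)
    = Lp_power \<mu> p (\<lambda>t. f t - g t)"
proof -
  have d: "(\<lambda>t. f t - g t) \<in> Lp_fun \<mu> p"
    using Lp_fun_diff[of p f \<mu> g] p f g by simp
  have fin: "eLp_norm \<mu> p (\<lambda>t. f t - g t) < \<infinity>"
    using d by (simp add: Lp_fun_def)
  have "ennreal (nrm (Lp \<mu> p) (diff (Lp \<mu> p) (Lp_class \<mu> p f) (Lp_class \<mu> p g)) powr p)
    = enn_powr (eLp_norm \<mu> p (\<lambda>t. f t - g t)) p"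
    using fin by (simp add: diff_Lp_class[OF f g] nrm_Lp_class[OF d] enn_powr_def less_top)
  then show ?thesis
    by (simp add: eLp_norm_eq_Lp_power enn_powr_inverse p)
qed

section \<open>Quantization error as an infimum of distortions\<close>

text \<open>
  Codebooks consist of representatives instead of equivalence classes, so that coordinates can be
  taken pointwise.  Two functions of a codebook may represent the same class; this only wastes a
  code point.
\<close>

definition codebooks :: "'t measure \<Rightarrow> real \<Rightarrow> nat \<Rightarrow> ('t \<Rightarrow> 'e::euclidean_space) set set" where
  "codebooks \<mu> p m = {F. F \<subseteq> Lp_fun \<mu> p \<and> finite F \<and> F \<noteq> {} \<and> card F \<le> m}"

definition distortion ::
  "'w measure \<Rightarrow> 't measure \<Rightarrow> real \<Rightarrow> ('t \<Rightarrow> 'w \<Rightarrow> 'e::euclidean_space) \<Rightarrow> ('t \<Rightarrow> 'e) set \<Rightarrow> ennreal"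
where
  "distortion M \<mu> p Y F = (\<integral>\<^sup>+\<omega>. (INF f\<in>F. Lp_power \<mu> p (\<lambda>t. Y t \<omega> - f t)) \<partial>M)"

text \<open>
  Almost every path lies in \<open>L\<^sup>p\<close>, and for such a path the distance of classes is the norm of the
  difference of representatives.  The remaining paths have the empty set as their
  class, but they form a null set.
\<close>

lemma nn_integral_Min_Lp_class:
  fixes Y :: "'t \<Rightarrow> 'w \<Rightarrow> 'e::euclidean_space"
  assumes p: "0 < p" and sf: "sigma_finite_measure \<mu>"
    and Y: "(\<lambda>(\<omega>, t). Y t \<omega>) \<in> borel_measurable (M \<Otimes>\<^sub>M \<mu>)"
    and fin: "(\<integral>\<^sup>+\<omega>. Lp_power \<mu> p (\<lambda>t. Y t \<omega>) \<partial>M) < \<infinity>"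
    and F: "F \<subseteq> Lp_fun \<mu> p" "finite F" "F \<noteq> {}"
  shows "(\<integral>\<^sup>+\<omega>. Min ((\<lambda>a. ennreal (nrm (Lp \<mu> p) (diff (Lp \<mu> p) (Lp_class \<mu> p (\<lambda>t. Y t \<omega>)) a) powr p))
      ` Lp_class \<mu> p ` F) \<partial>M) = distortion M \<mu> p Y F"
  unfolding distortion_def
proof (rule nn_integral_cong_AE)
  have "(\<lambda>\<omega>. Lp_power \<mu> p (\<lambda>t. Y t \<omega> - 0)) \<in> borel_measurable M"
    by (rule borel_measurable_Lp_power_section[OF sf Y]) simp
  then have "AE \<omega> in M. Lp_power \<mu> p (\<lambda>t. Y t \<omega>) \<noteq> \<infinity>"
    using fin by (intro nn_integral_noteq_infinite) auto
  with AE_space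
  show "AE \<omega> in M. Min ((\<lambda>a. ennreal (nrm (Lp \<mu> p)
        (diff (Lp \<mu> p) (Lp_class \<mu> p (\<lambda>t. Y t \<omega>)) a) powr p)) ` Lp_class \<mu> p ` F)
      = (INF f\<in>F. Lp_power \<mu> p (\<lambda>t. Y t \<omega> - f t))"
  proof eventually_elim
    case (elim \<omega>)
    have "(\<lambda>t. Y t \<omega>) \<in> borel_measurable \<mu>"
      using measurable_Pair2[OF Y, of \<omega>] elim by simp
    then have "(\<lambda>t. Y t \<omega>) \<in> Lp_fun \<mu> p"
      using elim by (simp add: Lp_fun_iff less_top)
    then have "(\<lambda>f. ennreal (nrm (Lp \<mu> p) (diff (Lp \<mu> p) (Lp_class \<mu> p (\<lambda>t. Y t \<omega>)) (Lp_class \<mu> p f)) powr p)) ` F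
        = (\<lambda>f. Lp_power \<mu> p (\<lambda>t. Y t \<omega> - f t)) ` F"
      using F by (intro image_cong refl ennreal_nrm_diff_Lp_class_powr p) auto
    then show ?case
      using F by (simp add: image_image Min_Inf)
  qed
qed

text \<open>
  Since \<open>x \<mapsto> x\<^sup>p\<close> is an order isomorphism of \<open>[0, \<infinity>]\<close>, the outer exponent moves inside the infimum
  and cancels.
\<close>

lemma enn_powr_quant_error:
  fixes Y :: "'t \<Rightarrow> 'w \<Rightarrow> 'e::euclidean_space"
  assumes p: "0 < p" and sf: "sigma_finite_measure \<mu>"
    and Y: "(\<lambda>(\<omega>, t). Y t \<omega>) \<in> borel_measurable (M \<Otimes>\<^sub>M \<mu>)"
    and fin: "(\<integral>\<^sup>+\<omega>. Lp_power \<mu> p (\<lambda>t. Y t \<omega>) \<partial>M) < \<infinity>"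
  shows "enn_powr (quant_error M m p (\<lambda>\<omega>. Lp_class \<mu> p (\<lambda>t. Y t \<omega>)) (Lp \<mu> p)) p
    = (INF F\<in>codebooks \<mu> p m. distortion M \<mu> p Y F)" (is "enn_powr ?Q p = ?I")
proof (rule antisym)
  note integral_eq = nn_integral_Min_Lp_class[OF p sf Y fin]
  have points: "points (Lp \<mu> p) = Lp_class \<mu> p ` Lp_fun \<mu> p"
    by (auto simp: Lp_def Lp_class_def quotient_def)
  show "enn_powr ?Q p \<le> ?I"
  proof (rule INF_greatest)
    fix F :: "('t \<Rightarrow> 'e) set" assume "F \<in> codebooks \<mu> p m"
    then have F: "F \<subseteq> Lp_fun \<mu> p" "finite F" "F \<noteq> {}" "card F \<le> m"
      by (auto simp: codebooks_def)
    have "?Q \<le> enn_powr (distortion M \<mu> p Y F) (1 / p)"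
      unfolding quant_error_def
    proof (rule Inf_lower, rule CollectI, intro exI conjI)
      show "enn_powr (distortion M \<mu> p Y F) (1 / p) = enn_powr (\<integral>\<^sup>+\<omega>. Min ((\<lambda>a. ennreal (nrm (Lp \<mu> p)
          (diff (Lp \<mu> p) (Lp_class \<mu> p (\<lambda>t. Y t \<omega>)) a) powr p)) ` Lp_class \<mu> p ` F) \<partial>M) (1 / p)"
        by (simp only: integral_eq[OF F(1-3)])
      show "card (Lp_class \<mu> p ` F) \<le> m"
        using F card_image_le[of F "Lp_class \<mu> p"] by simp
      show "1 \<le> card (Lp_class \<mu> p ` F)"
        using F by (simp add: Suc_le_eq card_gt_0_iff)
    qed (use F points in auto)
    then have "enn_powr ?Q p \<le> enn_powr (enn_powr (distortion M \<mu> p Y F) (1 / p)) p"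
      using p by (intro enn_powr_mono) auto
    then show "enn_powr ?Q p \<le> distortion M \<mu> p Y F"
      by (simp add: enn_powr_inverse p)
  qed
  have "enn_powr ?I (1 / p) \<le> ?Q"
    unfolding quant_error_def
  proof (rule Inf_greatest)
    fix x
    assume "x \<in> {enn_powr (\<integral>\<^sup>+\<omega>. Min ((\<lambda>a. ennreal (nrm (Lp \<mu> p) (diff (Lp \<mu> p)
            (Lp_class \<mu> p (\<lambda>t. Y t \<omega>)) a) powr p)) ` \<alpha>) \<partial>M) (1 / p)
          | \<alpha>. \<alpha> \<subseteq> points (Lp \<mu> p) \<and> finite \<alpha> \<and> 1 \<le> card \<alpha> \<and> card \<alpha> \<le> m}"
    then obtain \<alpha> where \<alpha>: "\<alpha> \<subseteq> points (Lp \<mu> p)" "finite \<alpha>" "1 \<le> card \<alpha>" "card \<alpha> \<le> m"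
      and x: "x = enn_powr (\<integral>\<^sup>+\<omega>. Min ((\<lambda>a. ennreal (nrm (Lp \<mu> p) (diff (Lp \<mu> p)
            (Lp_class \<mu> p (\<lambda>t. Y t \<omega>)) a) powr p)) ` \<alpha>) \<partial>M) (1 / p)"
      by blast
    obtain F where F: "F \<subseteq> Lp_fun \<mu> p" "inj_on (Lp_class \<mu> p) F" "\<alpha> = Lp_class \<mu> p ` F"
      using \<alpha>(1) unfolding points by (auto simp: subset_image_inj)
    have F': "finite F" "F \<noteq> {}" "card F \<le> m"
      using \<alpha> F finite_imageD by (auto simp: card_image)
    have "?I \<le> distortion M \<mu> p Y F"
      using F F' by (intro INF_lower) (auto simp: codebooks_def)
    then have "enn_powr ?I (1 / p) \<le> enn_powr (distortion M \<mu> p Y F) (1 / p)"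
      using p by (intro enn_powr_mono) auto
    then show "enn_powr ?I (1 / p) \<le> x"
      unfolding x F(3) by (simp only: integral_eq[OF F(1) F'(1,2)])
  qed
  then have "enn_powr (enn_powr ?I (1 / p)) p \<le> enn_powr ?Q p"
    using p by (intro enn_powr_mono) auto
  then show "?I \<le> enn_powr ?Q p"
    by (simp add: enn_powr_inverse p)
qed

section \<open>Sums of infima over independent choices\<close>

text \<open>
  Independent choices of near-minimisers in finitely many coordinates form a single element of the
  product, and their errors add up to an arbitrarily small amount.
\<close>

lemma INF_PiE_sum_le:
  fixes c :: "'i \<Rightarrow> 'a \<Rightarrow> ennreal"
  assumes I: "finite I"
  shows "(INF f\<in>Pi\<^sub>E I A. \<Sum>i\<in>I. c i (f i)) \<le> (\<Sum>i\<in>I. INF a\<in>A i. c i a)"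
proof (rule ennreal_le_epsilon)
  fix e :: real
  assume top: "(\<Sum>i\<in>I. INF a\<in>A i. c i a) < top" and e: "0 < e"
  \<comment> \<open>The summand 1 keeps the denominator positive for empty \<open>I\<close>.\<close>
  define e' where "e' = e / (card I + 1)"
  have e': "0 < e'" "card I * e' \<le> e"
    using e by (auto simp: e'_def field_simps)
  \<comment> \<open>A strict increase is needed for some element to lie below it; it requires a finite infimum.\<close>
  have strict: "x < x + ennreal e'" if "x < top" for x
    using that e'(1) ennreal_add_left_cancel_less[of x 0 "ennreal e'"] by (simp add: less_top)
  have "\<exists>a\<in>A i. c i a \<le> (INF a\<in>A i. c i a) + ennreal e'" if "i \<in> I" for i
  proof -
    have "(INF a\<in>A i. c i a) < top"
      using top that I by simp
    then have "(INF a\<in>A i. c i a) < (INF a\<in>A i. c i a) + ennreal e'"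
      by (rule strict)
    then show ?thesis
      unfolding INF_less_iff by (blast intro: less_imp_le)
  qed
  then obtain g where g: "\<And>i. i \<in> I \<Longrightarrow> g i \<in> A i"
      "\<And>i. i \<in> I \<Longrightarrow> c i (g i) \<le> (INF a\<in>A i. c i a) + ennreal e'"
    by metis
  have "(INF f\<in>Pi\<^sub>E I A. \<Sum>i\<in>I. c i (f i)) \<le> (\<Sum>i\<in>I. c i (restrict g I i))"
    using g(1) by (intro INF_lower) auto
  also have "\<dots> \<le> (\<Sum>i\<in>I. (INF a\<in>A i. c i a) + ennreal e')"
    using g(2) by (intro sum_mono) auto
  also have "\<dots> = (\<Sum>i\<in>I. INF a\<in>A i. c i a) + ennreal (card I * e')"
    using e' by (simp add: sum.distrib ennreal_mult ennreal_of_nat_eq_real_of_nat)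
  also have "\<dots> \<le> (\<Sum>i\<in>I. INF a\<in>A i. c i a) + ennreal e"
    using e' by (intro add_left_mono ennreal_leI)
  finally show "(INF f\<in>Pi\<^sub>E I A. \<Sum>i\<in>I. c i (f i)) \<le> (\<Sum>i\<in>I. INF a\<in>A i. c i a) + ennreal e" .
qed

section \<open>Projected and product codebooks\<close>

lemma nn_integral_sum_INF_Lp_power:
  fixes Z :: "'i \<Rightarrow> 't \<Rightarrow> 'w \<Rightarrow> 'e::euclidean_space"
  assumes "sigma_finite_measure \<mu>"
    and "\<And>i. i \<in> I \<Longrightarrow> (\<lambda>(\<omega>, t). Z i t \<omega>) \<in> borel_measurable (M \<Otimes>\<^sub>M \<mu>)"
    and "\<And>i. i \<in> I \<Longrightarrow> F i \<in> codebooks \<mu> p (m i)"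
  shows "(\<integral>\<^sup>+\<omega>. (\<Sum>i\<in>I. INF f\<in>F i. Lp_power \<mu> p (\<lambda>t. Z i t \<omega> - f t)) \<partial>M)
    = (\<Sum>i\<in>I. distortion M \<mu> p (Z i) (F i))"
  unfolding distortion_def
proof (rule nn_integral_sum)
  fix i assume i: "i \<in> I"
  then have F: "countable (F i)" "F i \<subseteq> borel_measurable \<mu>"
    using assms(3)[OF i] by (auto simp: codebooks_def Lp_fun_iff countable_finite)
  show "(\<lambda>\<omega>. INF f\<in>F i. Lp_power \<mu> p (\<lambda>t. Z i t \<omega> - f t)) \<in> borel_measurable M"
    by (intro borel_measurable_INF F borel_measurable_Lp_power_section[OF assms(1,2)] i)
      (use F in blast)
qed

text \<open>
  A code function that serves a whole path need not be the best choice for any of the coordinates.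
\<close>

lemma sum_distortion_projections_le:
  fixes X :: "'t \<Rightarrow> 'w \<Rightarrow> real ^ 'd"
  assumes sf: "sigma_finite_measure \<mu>"
    and X: "\<And>i. (\<lambda>(\<omega>, t). X t \<omega> $ i) \<in> borel_measurable (M \<Otimes>\<^sub>M \<mu>)"
    and F: "F \<in> codebooks \<mu> p n"
  shows "(\<lambda>f t. f t $ i) ` F \<in> codebooks \<mu> p n"
    and "(\<Sum>i\<in>UNIV. distortion M \<mu> p (\<lambda>t \<omega>. X t \<omega> $ i) ((\<lambda>f t. f t $ i) ` F)) \<le> distortion M \<mu> p X F"
proof -
  show cb: "(\<lambda>f t. f t $ i) ` F \<in> codebooks \<mu> p n" for i
    using F card_image_le[of F "\<lambda>f t. f t $ i"]
    by (auto simp: codebooks_def Lp_fun_vec_iff)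
  have "(\<Sum>i\<in>UNIV. distortion M \<mu> p (\<lambda>t \<omega>. X t \<omega> $ i) ((\<lambda>f t. f t $ i) ` F))
    = (\<integral>\<^sup>+\<omega>. (\<Sum>i\<in>UNIV. INF f\<in>(\<lambda>f t. f t $ i) ` F. Lp_power \<mu> p (\<lambda>t. X t \<omega> $ i - f t)) \<partial>M)"
    by (rule nn_integral_sum_INF_Lp_power[symmetric, OF sf X cb])
  also have "\<dots> \<le> distortion M \<mu> p X F"
    unfolding distortion_def Lp_power_vec
    by (intro nn_integral_mono INF_greatest sum_mono)
      (auto simp: image_image intro: INF_lower)
  finally show "(\<Sum>i\<in>UNIV. distortion M \<mu> p (\<lambda>t \<omega>. X t \<omega> $ i) ((\<lambda>f t. f t $ i) ` F)) \<le> distortion M \<mu> p X F" .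
qed

text \<open>
  Every tuple of code functions, one from each \<open>A i\<close>, is itself a code function of the product, so
  each path may use its best approximation in every coordinate simultaneously.
\<close>

lemma distortion_product_codebook_le:
  fixes X :: "'t \<Rightarrow> 'w \<Rightarrow> real ^ 'd" and A :: "'d \<Rightarrow> ('t \<Rightarrow> real) set"
  assumes sf: "sigma_finite_measure \<mu>"
    and X: "\<And>i. (\<lambda>(\<omega>, t). X t \<omega> $ i) \<in> borel_measurable (M \<Otimes>\<^sub>M \<mu>)"
    and A: "\<And>i. A i \<in> codebooks \<mu> p (ns i)"
    and le: "(\<Prod>i\<in>UNIV. ns i) \<le> n"
  defines "P \<equiv> (\<lambda>f t. \<chi> i. f i t) ` Pi\<^sub>E UNIV A"
  shows "P \<in> codebooks \<mu> p n"
    and "distortion M \<mu> p X P \<le> (\<Sum>i\<in>UNIV. distortion M \<mu> p (\<lambda>t \<omega>. X t \<omega> $ i) (A i))"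
proof -
  have A': "finite (A i)" "A i \<noteq> {}" "card (A i) \<le> ns i" "A i \<subseteq> Lp_fun \<mu> p" for i
    using A[of i] by (auto simp: codebooks_def)
  have fin: "finite (Pi\<^sub>E UNIV A)"
    by (intro finite_PiE) (auto simp: A')
  have "card P \<le> card (Pi\<^sub>E UNIV A)"
    unfolding P_def by (rule card_image_le[OF fin])
  also have "\<dots> = (\<Prod>i\<in>UNIV. card (A i))"
    by (simp add: card_PiE)
  also have "\<dots> \<le> (\<Prod>i\<in>UNIV. ns i)"
    by (intro prod_mono) (auto simp: A')
  finally have "card P \<le> n"
    using le by simp
  moreover have "P \<subseteq> Lp_fun \<mu> p"
    using A'(4) by (fastforce simp: P_def Lp_fun_vec_iff PiE_iff)
  ultimately show "P \<in> codebooks \<mu> p n"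
    using fin A'(2) by (auto simp: codebooks_def P_def PiE_eq_empty_iff)
  have "distortion M \<mu> p X P
    = (\<integral>\<^sup>+\<omega>. (INF f\<in>Pi\<^sub>E UNIV A. \<Sum>i\<in>UNIV. Lp_power \<mu> p (\<lambda>t. X t \<omega> $ i - f i t)) \<partial>M)"
    by (simp add: distortion_def P_def Lp_power_vec image_image)
  also have "\<dots> \<le> (\<integral>\<^sup>+\<omega>. (\<Sum>i\<in>UNIV. INF f\<in>A i. Lp_power \<mu> p (\<lambda>t. X t \<omega> $ i - f t)) \<partial>M)"
    by (intro nn_integral_mono INF_PiE_sum_le) simp
  also have "\<dots> = (\<Sum>i\<in>UNIV. distortion M \<mu> p (\<lambda>t \<omega>. X t \<omega> $ i) (A i))"
    by (rule nn_integral_sum_INF_Lp_power[OF sf X A])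
  finally show "distortion M \<mu> p X P \<le> (\<Sum>i\<in>UNIV. distortion M \<mu> p (\<lambda>t \<omega>. X t \<omega> $ i) (A i))" .
qed

section \<open>Comparison of the quantization errors\<close>

theorem proposition4:
  fixes M :: "'w measure" and \<mu> :: "'t measure" and p :: real
    and X :: "'t \<Rightarrow> 'w \<Rightarrow> real ^ 'd"
    and n :: nat and ns :: "'d \<Rightarrow> nat"
  assumes "prob_space M"
    and "1 \<le> p"
    and "finite_measure \<mu>"
    and "separable_nspace (Lp \<mu> p :: ('t \<Rightarrow> real ^ 'd) set nspace)"
    and "(\<lambda>(\<omega>, t). X t \<omega>) \<in> borel_measurable (M \<Otimes>\<^sub>M \<mu>)"
    and "(\<integral>\<^sup>+\<omega>. enn_powr (eLp_norm \<mu> p (\<lambda>t. X t \<omega>)) p \<partial>M) < \<infinity>"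
    and "1 \<le> n" and "\<forall>i. 1 \<le> ns i"
    and "(\<Prod>i\<in>UNIV. ns i) \<le> n"
  shows
    "(\<Sum>i\<in>UNIV. enn_powr (quant_error M n p (\<lambda>\<omega>. Lp_class \<mu> p (\<lambda>t. X t \<omega> $ i)) (Lp \<mu> p)) p)
       \<le> enn_powr (quant_error M n p (\<lambda>\<omega>. Lp_class \<mu> p (\<lambda>t. X t \<omega>)) (Lp \<mu> p)) p
     \<and> enn_powr (quant_error M n p (\<lambda>\<omega>. Lp_class \<mu> p (\<lambda>t. X t \<omega>)) (Lp \<mu> p)) p
       \<le> (\<Sum>i\<in>UNIV. enn_powr (quant_error M (ns i) p (\<lambda>\<omega>. Lp_class \<mu> p (\<lambda>t. X t \<omega> $ i)) (Lp \<mu> p)) p)"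
proof -
  interpret finite_measure \<mu> by fact
  have sf: "sigma_finite_measure \<mu>"
    by (rule sigma_finite_measure_axioms)
  have p: "0 < p"
    using assms(2) by simp
  note X = assms(5)
  have Xi: "(\<lambda>(\<omega>, t). X t \<omega> $ i) \<in> borel_measurable (M \<Otimes>\<^sub>M \<mu>)" for i
    using borel_measurable_vec_nth[OF X, of i] by (simp only: case_prod_unfold)
  have fin: "(\<integral>\<^sup>+\<omega>. Lp_power \<mu> p (\<lambda>t. X t \<omega>) \<partial>M) < \<infinity>"
    using assms(6) by (simp add: eLp_norm_eq_Lp_power enn_powr_inverse p)
  have fini: "(\<integral>\<^sup>+\<omega>. Lp_power \<mu> p (\<lambda>t. X t \<omega> $ i) \<partial>M) < \<infinity>" for i
  proof (rule le_less_trans[OF nn_integral_mono fin])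
    show "Lp_power \<mu> p (\<lambda>t. X t \<omega> $ i) \<le> Lp_power \<mu> p (\<lambda>t. X t \<omega>)" for \<omega>
      unfolding Lp_power_vec[of \<mu> p "\<lambda>t. X t \<omega>"] by (rule member_le_sum) auto
  qed
  note eqX = enn_powr_quant_error[OF p sf X fin]
  note eqXi = enn_powr_quant_error[OF p sf Xi fini]
  let ?D = "\<lambda>i. distortion M \<mu> p (\<lambda>t \<omega>. X t \<omega> $ i)"
  have lower: "(\<Sum>i\<in>UNIV. INF F\<in>codebooks \<mu> p n. ?D i F)
      \<le> (INF F\<in>codebooks \<mu> p n. distortion M \<mu> p X F)"
  proof (rule INF_greatest)
    fix F :: "('t \<Rightarrow> real ^ 'd) set" assume F: "F \<in> codebooks \<mu> p n"
    have "(\<Sum>i\<in>UNIV. INF F\<in>codebooks \<mu> p n. ?D i F) \<le> (\<Sum>i\<in>UNIV. ?D i ((\<lambda>f t. f t $ i) ` F))"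
      by (intro sum_mono INF_lower sum_distortion_projections_le(1)[OF sf Xi F])
    also have "\<dots> \<le> distortion M \<mu> p X F"
      by (rule sum_distortion_projections_le(2)[OF sf Xi F])
    finally show "(\<Sum>i\<in>UNIV. INF F\<in>codebooks \<mu> p n. ?D i F) \<le> distortion M \<mu> p X F" .
  qed
  have "(INF F\<in>codebooks \<mu> p n. distortion M \<mu> p X F)
      \<le> (INF A\<in>(\<Pi>\<^sub>E i\<in>UNIV. codebooks \<mu> p (ns i)). \<Sum>i\<in>UNIV. ?D i (A i))"
  proof (rule INF_greatest)
    fix A :: "'d \<Rightarrow> ('t \<Rightarrow> real) set"
    assume "A \<in> (\<Pi>\<^sub>E i\<in>UNIV. codebooks \<mu> p (ns i))"
    then have "A i \<in> codebooks \<mu> p (ns i)" for i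
      by auto
    note product = distortion_product_codebook_le[where X = X, OF sf Xi this assms(9)]
    show "(INF F\<in>codebooks \<mu> p n. distortion M \<mu> p X F) \<le> (\<Sum>i\<in>UNIV. ?D i (A i))"
      by (rule INF_lower2) (rule product)+
  qed
  also have "\<dots> \<le> (\<Sum>i\<in>UNIV. INF F\<in>codebooks \<mu> p (ns i). ?D i F)"
    by (intro INF_PiE_sum_le) simp
  finally show ?thesis
    unfolding eqX eqXi by (rule conjI[OF lower])
qed

end
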